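(* Let $\mathbf{s}=(s_k)_{k\ge 0}$ be a sequence of real or complex numbers and let $m$ be a positive integer. Then $D_{-m,n}(\mathbf{s})=0$ for $0<n\le m$, and for every integer $n\ge 0$, $$D_{-m,n+m+1}(\mathbf{s})=(-1)^{\binom{m+1}{2}}\,D_{m,n}(E\mathbf{s}),$$ where $E\mathbf{s}=(s_{k+1})_{k\ge 0}$ is the shifted sequence.
   Context: For a sequence $\mathbf{s}=(s_k)_{k\ge0}$ define numbers $a_{n,k}(\mathbf{s})$ for $n\ge 0$, $k\in\mathbb{Z}$ by $a_{0,k}(\mathbf{s})=[k=0]$ (i.e. $1$ if $k=0$, else $0$), $a_{n,k}(\mathbf{s})=0$ for $k<0$, and for $n\ge1$, $k\ge 0$: $a_{n,k}(\mathbf{s})=a_{n-1,k-1}(\mathbf{s})+s_k\,a_{n-1,k}(\mathbf{s})+a_{n-1,k+1}(\mathbf{s})$. Extend to all $n\in\mathbb{Z}$ by $a_{n,k}(\mathbf{s})=0$ for $n<0$. Write $a_n(\mathbf{s})=a_{n,0}(\mathbf{s})$. For $m\in\mathbb{Z}$ and $n\ge 0$ define the Hankel determinant $D_{m,n}(\mathbf{s})=\det\left(a_{i+j+m}(\mathbf{s})\right)_{i,j=0}^{n-1}$, with $D_{m,0}(\mathbf{s})=1$. *)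

theory Defs
  imports Complex_Main "Jordan_Normal_Form.Determinant"
begin

text \<open>The totals of weighted Motzkin paths of length \<open>n\<close> ending at height \<open>k\<close>, where a level step
  at height \<open>j\<close> has weight \<open>s j\<close>; they are 0 for \<open>k < 0\<close>.\<close>

primrec motzkin_nat :: "(nat \<Rightarrow> 'a::comm_ring_1) \<Rightarrow> nat \<Rightarrow> int \<Rightarrow> 'a" where
  "motzkin_nat s 0 k = (if k = 0 then 1 else 0)"
| "motzkin_nat s (Suc n) k =
     (if k < 0 then 0
      else motzkin_nat s n (k - 1) + s (nat k) * motzkin_nat s n k + motzkin_nat s n (k + 1))"

definition motzkin :: "(nat \<Rightarrow> 'a::comm_ring_1) \<Rightarrow> int \<Rightarrow> int \<Rightarrow> 'a" where
  "motzkin s n k = (if n < 0 then 0 else motzkin_nat s (nat n) k)"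

text \<open>For \<open>n = 0\<close> the determinant of the empty matrix is 1, as required.\<close>

definition hankel_det :: "(nat \<Rightarrow> 'a::comm_ring_1) \<Rightarrow> int \<Rightarrow> nat \<Rightarrow> 'a" where
  "hankel_det s m n = det (mat n n (\<lambda>(i, j). motzkin s (int i + int j + m) 0))"

definition shift :: "(nat \<Rightarrow> 'a) \<Rightarrow> nat \<Rightarrow> 'a" where
  "shift s = (\<lambda>k. s (Suc k))"

end

theory Submission
  imports Defs "HOL-Computational_Algebra.Formal_Power_Series"
begin

text \<open>Moving the last column to the front costs \<open>n\<close> transpositions and splits off
  a 1 by 1 identity block, so the sign exponents add up to 0 + 1 + ... + (n - 1).\<close>

lemma det_exchange_mat:
  "det (mat n n (\<lambda>(i, j). if Suc (i + j) = n then 1 else 0) :: 'a::idom mat) = (-1) ^ (n choose 2)"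
proof (induction n)
  case 0
  show ?case by (simp add: numeral_2_eq_2)
next
  case (Suc n)
  let ?J = "\<lambda>n. mat n n (\<lambda>(i, j). if Suc (i + j) = n then 1 else 0) :: 'a mat"
  have J: "?J (Suc n) \<in> carrier_mat (1 + n) (1 + n)" by simp
  have "mat (1 + n) (1 + n) (\<lambda>(i, j). ?J (Suc n) $$ (i, if j < 1 then j + n else j - 1))
      = four_block_mat (1\<^sub>m 1) (0\<^sub>m 1 n) (0\<^sub>m n 1) (?J n)"
    by (rule eq_matI) auto
  then have "det (?J (Suc n)) = (-1) ^ n * det (?J n)"
    using det_swap_cols[OF J]
    by (simp add: det_four_block_mat_upper_right_zero[where n = 1 and m = n])
  then show ?case
    using Suc.IH by (simp add: numeral_2_eq_2 power_add)
qed

text \<open>Reversing the columns is right multiplication by the exchange matrix.\<close>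

lemma det_reverse_cols:
  fixes f :: "nat \<Rightarrow> nat \<Rightarrow> 'a::idom"
  shows "det (mat n n (\<lambda>(i, j). f i (n - 1 - j))) = (-1) ^ (n choose 2) * det (mat n n (\<lambda>(i, j). f i j))"
proof -
  let ?J = "mat n n (\<lambda>(i, j). if Suc (i + j) = n then 1 else 0) :: 'a mat"
  let ?A = "mat n n (\<lambda>(i, j). f i j)"
  have "mat n n (\<lambda>(i, j). f i (n - 1 - j)) = ?A * ?J"
  proof (rule eq_matI)
    fix i j assume ij: "i < dim_row (?A * ?J)" "j < dim_col (?A * ?J)"
    then have "Suc (k + j) = n \<longleftrightarrow> k = n - 1 - j" for k by auto
    then show "mat n n (\<lambda>(i, j). f i (n - 1 - j)) $$ (i, j) = (?A * ?J) $$ (i, j)"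
      using ij by (simp add: scalar_prod_def mult_delta_right)
  qed auto
  then show ?thesis
    using det_exchange_mat[of n, where 'a = 'a] by (simp add: det_mult[of _ n])
qed

text \<open>A case of Jacobi's complementary minor theorem: replace the last \<open>N\<close> columns of \<open>B\<close> by
  the first \<open>N\<close> unit vectors and multiply by \<open>A\<close> from the left.\<close>

lemma det_complementary_minor:
  fixes A B :: "'a::idom mat"
  assumes A: "A \<in> carrier_mat (n + N) (n + N)" and B: "B \<in> carrier_mat (n + N) (n + N)"
    and AB: "A * B = 1\<^sub>m (n + N)"
  shows "det (mat N N (\<lambda>(i, j). A $$ (n + i, j)))
       = (-1) ^ (n * N) * det A * det (mat n n (\<lambda>(i, j). B $$ (N + i, j)))"
proof -
  let ?M = "mat N N (\<lambda>(i, j). A $$ (n + i, j))"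
  let ?C = "mat n n (\<lambda>(i, j). B $$ (N + i, j))"
  let ?Y = "mat (N + n) (N + n) (\<lambda>(i, j). if j < n then B $$ (i, j) else if i = j - n then 1 else 0)"
  have Y: "?Y \<in> carrier_mat (N + n) (N + n)" by simp
  \<comment> \<open>Moving the \<open>N\<close> unit vectors in front of the \<open>n\<close>
    columns of \<open>B\<close> gives a block triangular matrix; the cyclic shift has sign
    \<open>(-1) ^ (n * N)\<close>.\<close>
  have "mat (N + n) (N + n) (\<lambda>(i, j). ?Y $$ (i, if j < N then j + n else j - N))
      = four_block_mat (1\<^sub>m N) (mat N n (\<lambda>(i, j). B $$ (i, j))) (0\<^sub>m n N) ?C"
    by (rule eq_matI) auto
  then have detY: "det ?Y = (-1) ^ (n * N) * det ?C"
    using det_swap_cols[OF Y]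
    by (simp add: det_four_block_mat_lower_left_zero[where n = N and m = n] mult.commute)
  \<comment> \<open>The columns taken from \<open>B\<close> become columns of the identity because
    \<open>A * B\<close> is the identity; the unit vectors pick out the first \<open>N\<close>
    columns of \<open>A\<close>, whose lower part is \<open>?M\<close>.\<close>
  have "A * ?Y = four_block_mat (1\<^sub>m n) (mat n N (\<lambda>(i, j). A $$ (i, j))) (0\<^sub>m N n) ?M"
    (is "_ = ?R")
  proof (rule eq_matI)
    fix i j assume "i < dim_row ?R" "j < dim_col ?R"
    then have i: "i < n + N" and j: "j < n + N" by auto
    show "(A * ?Y) $$ (i, j) = ?R $$ (i, j)"
    proof (cases "j < n")
      case True
      then have "col ?Y j = col B j"
        using B by (intro eq_vecI) auto
      then have "(A * ?Y) $$ (i, j) = (A * B) $$ (i, j)"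
        using A B i j by simp
      then show ?thesis
        using AB True i j by auto
    next
      case False
      have "(A * ?Y) $$ (i, j) = A $$ (i, j - n)"
        using A i j False by (auto simp: scalar_prod_def mult_delta_right)
      then show ?thesis
        using False i j by auto
    qed
  qed (use A in auto)
  then have "det A * det ?Y = det ?M"
    using A Y by (simp add: det_mult[of A "n + N" ?Y, symmetric] add.commute
        det_four_block_mat_lower_left_zero[where n = n and m = N])
  then show ?thesis
    using detY by (simp add: ac_simps)
qed

text \<open>In the basis of powers of X this is multiplication by \<open>f\<close> modulo X^n, which
  is why products of series become products of matrices.\<close>

definition toeplitz_mat :: "nat \<Rightarrow> 'a::zero fps \<Rightarrow> 'a mat" where
  "toeplitz_mat n f = mat n n (\<lambda>(i, j). if j \<le> i then fps_nth f (i - j) else 0)"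

lemma toeplitz_mat_carrier [simp]: "toeplitz_mat n f \<in> carrier_mat n n"
  by (simp add: toeplitz_mat_def)

lemma toeplitz_mat_1: "toeplitz_mat n 1 = 1\<^sub>m n"
  by (rule eq_matI) (auto simp: toeplitz_mat_def)

lemma toeplitz_mat_mult:
  "toeplitz_mat n f * toeplitz_mat n g = toeplitz_mat n (f * g :: 'a::comm_ring_1 fps)"
proof (rule eq_matI)
  fix i j
  assume "i < dim_row (toeplitz_mat n (f * g))" "j < dim_col (toeplitz_mat n (f * g))"
  then have i: "i < n" and j: "j < n" by (auto simp: toeplitz_mat_def)
  have "(toeplitz_mat n f * toeplitz_mat n g) $$ (i, j)
      = (\<Sum>k<n. (if k \<le> i then fps_nth f (i - k) else 0) * (if j \<le> k then fps_nth g (k - j) else 0))"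
    using i j by (simp add: toeplitz_mat_def scalar_prod_def lessThan_atLeast0)
  also have "\<dots> = (\<Sum>k=j..i. fps_nth f (i - k) * fps_nth g (k - j))"
    using i by (intro sum.mono_neutral_cong_right) auto
  also have "\<dots> = (if j \<le> i then fps_nth (f * g) (i - j) else 0)"
  proof (cases "j \<le> i")
    case True
    have "(\<Sum>k=j..i. fps_nth f (i - k) * fps_nth g (k - j))
        = (\<Sum>k=0..i - j. fps_nth f k * fps_nth g (i - j - k))"
      using True
      by (intro sum.reindex_bij_witness[of _ "\<lambda>k. i - k" "\<lambda>k. i - k"]) auto
    then show ?thesis using True by (simp add: fps_mult_nth)
  qed auto
  finally show "(toeplitz_mat n f * toeplitz_mat n g) $$ (i, j) = toeplitz_mat n (f * g) $$ (i, j)"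
    using i j by (simp add: toeplitz_mat_def)
qed (simp_all add: toeplitz_mat_def)

lemma det_toeplitz_mat: "det (toeplitz_mat n f) = fps_nth f 0 ^ n" for f :: "'a::idom fps"
proof -
  have "det (toeplitz_mat n f) = prod_list (diag_mat (toeplitz_mat n f))"
    by (rule det_lower_triangular[of n]) (auto simp: toeplitz_mat_def)
  also have "\<dots> = fps_nth f 0 ^ n"
    by (simp add: prod_list_diag_prod toeplitz_mat_def)
  finally show ?thesis .
qed

lemma motzkin_nat_neg: "k < 0 \<Longrightarrow> motzkin_nat s n k = 0"
  by (cases n) auto

text \<open>Decomposition of a path ending above the axis at the last time \<open>j\<close> at which it visits
  height 0.\<close>

lemma motzkin_nat_last_passage:
  "motzkin_nat s n (int k + 1)
     = (\<Sum>j<n. motzkin_nat s j 0 * motzkin_nat (shift s) (n - 1 - j) (int k))"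
proof (induction n arbitrary: k)
  case 0
  then show ?case by simp
next
  case (Suc n)
  let ?a = "motzkin_nat s" and ?b = "motzkin_nat (shift s)"
  \<comment> \<open>For k = 0 the convolution vanishes, since it involves height -1; the separate
    term \<open>?a n 0\<close> later supplies the summand j = n of the sum up to
    \<open>Suc n\<close>.\<close>
  have low: "?a n (int k) = (if k = 0 then ?a n 0 else 0)
      + (\<Sum>j<n. ?a j 0 * ?b (n - 1 - j) (int k - 1))"
  proof (cases k)
    case 0
    then show ?thesis by (simp add: motzkin_nat_neg)
  next
    case (Suc k')
    then show ?thesis using Suc.IH[of k'] by (simp add: add.commute)
  qed
  have step: "?b (n - j) (int k) = ?b (n - 1 - j) (int k - 1)
      + s (Suc k) * ?b (n - 1 - j) (int k) + ?b (n - 1 - j) (int k + 1)" if "j < n" for j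
  proof -
    have "n - j = Suc (n - 1 - j)" using that by simp
    then show ?thesis by (simp add: shift_def)
  qed
  have "?a (Suc n) (int k + 1)
      = ?a n (int k) + s (Suc k) * ?a n (int k + 1) + ?a n (int (Suc k) + 1)"
    by (simp add: nat_add_distrib add.commute)
  also have "\<dots> = (if k = 0 then ?a n 0 else 0) + (\<Sum>j<n. ?a j 0 * ?b (n - j) (int k))"
    unfolding low Suc.IH
    by (simp add: step algebra_simps sum.distrib sum_distrib_left)
  also have "\<dots> = (\<Sum>j<Suc n. ?a j 0 * ?b (Suc n - 1 - j) (int k))"
    by simp
  finally show ?case by simp
qed

definition motzkin_fps :: "(nat \<Rightarrow> 'a::comm_ring_1) \<Rightarrow> 'a fps" where
  "motzkin_fps s = Abs_fps (\<lambda>n. motzkin_nat s n 0)"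

text \<open>A nonempty path returning to height 0 ends with a level step at height 0 or a down step
  from height 1. With A and B the two series, this gives A = 1 + s_0 X A + X^2 A B, the first stage
  of a continued fraction.\<close>

lemma motzkin_fps_inverse:
  "motzkin_fps s * (1 - fps_const (s 0) * fps_X - fps_X ^ 2 * motzkin_fps (shift s)) = 1"
proof -
  let ?A = "motzkin_fps s" and ?B = "motzkin_fps (shift s)"
  have "fps_nth ?A n = fps_nth (1 + fps_X * (fps_const (s 0) * ?A + fps_X * (?A * ?B))) n" for n
  proof (cases n)
    case 0
    then show ?thesis by (simp add: motzkin_fps_def)
  next
    case (Suc n')
    have "fps_nth (fps_X * (?A * ?B)) n' = motzkin_nat s n' 1"
    proof (cases n')
      case 0
      then show ?thesis by simp
    next
      case (Suc l)
      \<comment> \<open>Height 1 is written as \<open>int 0 + 1\<close> to match the last-passage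
        decomposition.\<close>
      have "fps_nth (?A * ?B) l = motzkin_nat s (Suc l) (int 0 + 1)"
        unfolding motzkin_nat_last_passage
        by (simp add: motzkin_fps_def fps_mult_nth atLeast0AtMost lessThan_Suc_atMost)
      then show ?thesis using Suc by simp
    qed
    then show ?thesis
      using Suc by (simp add: motzkin_fps_def motzkin_nat_neg)
  qed
  then have "?A = 1 + fps_X * (fps_const (s 0) * ?A + fps_X * (?A * ?B))"
    by (rule fps_ext)
  then show ?thesis
    by (simp add: algebra_simps power2_eq_square)
qed

text \<open>The first row has indices j - m with j < n \<le> m, all negative, so it
  vanishes.\<close>

lemma hankel_det_neg_eq_0:
  assumes "0 < n" "n \<le> m"
  shows "hankel_det s (- int m) n = (0 :: 'a::idom)"
proof -
  let ?M = "mat n n (\<lambda>(i, j). motzkin s (int i + int j + - int m) 0) :: 'a mat"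
  have "det ?M = (\<Sum>j<n. ?M $$ (0, j) * cofactor ?M 0 j)"
    using assms by (intro laplace_expansion_row) auto
  also have "\<dots> = 0"
    using assms by (intro sum.neutral) (auto simp: motzkin_def)
  finally have "det ?M = 0" .
  then show ?thesis by (simp add: hankel_det_def)
qed

text \<open>Reversing columns turns both Hankel matrices into complementary submatrices of the Toeplitz
  matrices of the mutually inverse power series \<open>f\<close> and \<open>g\<close>.\<close>

lemma hankel_det_neg_shift:
  fixes s :: "nat \<Rightarrow> 'a::idom"
  shows "hankel_det s (- int m) (n + m + 1)
    = (-1) ^ ((m + 1) choose 2) * hankel_det (shift s) (int m) n"
proof -
  define N where "N = n + m + 1"
  define f where "f = motzkin_fps s"
  define g where "g = 1 - fps_const (s 0) * fps_X - fps_X ^ 2 * motzkin_fps (shift s)"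
  let ?A = "toeplitz_mat (n + N) f" and ?B = "toeplitz_mat (n + N) g"
  \<comment> \<open>The index n + i - j equals i + (N - 1 - j) - m, and the zeros above the diagonal
    of \<open>?A\<close> are the zeros of \<open>motzkin\<close> at negative lengths.\<close>
  have A: "mat N N (\<lambda>(i, j). ?A $$ (n + i, j))
      = mat N N (\<lambda>(i, j). motzkin s (int i + int (N - 1 - j) + - int m) 0)"
    by (rule eq_matI)
      (auto simp: toeplitz_mat_def f_def motzkin_fps_def motzkin_def N_def nat_diff_distrib
        intro!: arg_cong[where f = "\<lambda>k. motzkin_nat s k 0"])
  have g_nth: "fps_nth g (k + 2) = - motzkin_nat (shift s) k 0" for k
    by (simp add: g_def motzkin_fps_def fps_X_power_mult_nth)
  \<comment> \<open>Since j < n, the index is at least m + 2, so the block avoids the coefficients 1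
    and -s_0 of \<open>g\<close>.\<close>
  have g_entry: "fps_nth g (N + i - j) = - motzkin (shift s) (int i + int (n - 1 - j) + int m) 0"
    if "j < n" for i j
  proof -
    have "N + i - j = (i + (n - 1 - j) + m) + 2" using that by (simp add: N_def)
    then show ?thesis by (simp only: g_nth) (simp add: motzkin_def nat_add_distrib)
  qed
  have B: "mat n n (\<lambda>(i, j). ?B $$ (N + i, j))
      = (-1) \<cdot>\<^sub>m mat n n (\<lambda>(i, j). motzkin (shift s) (int i + int (n - 1 - j) + int m) 0)"
    by (rule eq_matI) (simp_all add: toeplitz_mat_def g_entry del: of_nat_diff, simp add: N_def)
  have "?A * ?B = 1\<^sub>m (n + N)"
    by (simp add: toeplitz_mat_mult f_def g_def motzkin_fps_inverse toeplitz_mat_1)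
  moreover have "det ?A = 1"
    by (simp add: det_toeplitz_mat f_def motzkin_fps_def)
  ultimately have "det (mat N N (\<lambda>(i, j). ?A $$ (n + i, j)))
      = (-1) ^ (n * N) * det (mat n n (\<lambda>(i, j). ?B $$ (N + i, j)))"
    using det_complementary_minor[of ?A n N ?B] by simp
  then have rel: "(-1) ^ (N choose 2) * hankel_det s (- int m) N
      = (-1) ^ (n * N) * ((-1) ^ n * ((-1) ^ (n choose 2) * hankel_det (shift s) (int m) n))"
    unfolding A B det_smult
      det_reverse_cols[of N "\<lambda>i j. motzkin s (int i + int j + - int m) 0"]
      det_reverse_cols[of n "\<lambda>i j. motzkin (shift s) (int i + int j + int m) 0"]
    by (simp add: hankel_det_def)
  \<comment> \<open>The sign on the left of \<open>rel\<close> is its own inverse; only the parity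
    of the total exponent remains.\<close>
  have "hankel_det s (- int m) N
      = (-1) ^ (N choose 2) * ((-1) ^ (N choose 2) * hankel_det s (- int m) N)"
    by (simp flip: mult.assoc power_add)
  also have "\<dots> = (-1) ^ ((N choose 2) + n * N + n + (n choose 2)) * hankel_det (shift s) (int m) n"
    by (simp only: rel power_add mult.assoc)
  also have "(-1 :: 'a) ^ ((N choose 2) + n * N + n + (n choose 2)) = (-1) ^ ((m + 1) choose 2)"
  proof -
    \<comment> \<open>Pairs in a disjoint union of sizes n and m + 1: both in one part, or one in
      each.\<close>
    have "N choose 2 = (n choose 2) + ((m + 1) choose 2) + n * (m + 1)"
      unfolding N_def by (induction n) (auto simp: numeral_2_eq_2)
    then have "(N choose 2) + n * N + n + (n choose 2)
        = ((m + 1) choose 2) + (2 * ((n choose 2) + n * (m + 1)) + n * (n + 1))"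
      by (simp add: N_def algebra_simps)
    moreover have "even (2 * ((n choose 2) + n * (m + 1)) + n * (n + 1))" by simp
    ultimately show ?thesis by (simp only: power_add[of _ "(m + 1) choose 2"] neg_one_even_power mult_1_right)
  qed
  finally show ?thesis by (simp add: N_def)
qed

theorem theorem1:
  fixes s :: "nat \<Rightarrow> 'a::real_normed_field" and m :: nat
  assumes "m > 0"
  shows "(\<forall>n. 0 < n \<and> n \<le> m \<longrightarrow> hankel_det s (- int m) n = 0) \<and>
         (\<forall>n. hankel_det s (- int m) (n + m + 1)
              = (-1) ^ ((m + 1) choose 2) * hankel_det (shift s) (int m) n)"
  using hankel_det_neg_eq_0 hankel_det_neg_shift by blast

end
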